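(* Let $G$ be a 3-connected graph and let $A=\{e_1,\dots,e_n\}$ be a set of pairwise nonadjacent edges of $G$ such that the graph $G-A$ (same vertex set as $G$, edge set $E(G)\setminus A$) has exactly two connected components $G_1$ and $G_2$, and each edge of $A$ has one end vertex in $G_1$ and the other in $G_2$. Then either $G$ has a subgraph of type $X$ whose three connectors all belong to $A$, or there exists a circuit of $G$ containing at least four distinct edges of $A$.
   Context: Graphs are undirected, finite or infinite, without loops or multiple edges; a circuit is a (finite) cycle. A graph of type $X$ is a graph consisting of two vertex-disjoint circuits $A_0$ and $B_0$, two edges $e_1=(a_1,b_1)$ and $e_2=(a_2,b_2)$, and a path $P(a_3,b_3)$ which shares no vertex with $A_0$ or $B_0$ except its end vertices $a_3$ and $b_3$, where $a_1,a_2,a_3$ are distinct vertices of $A_0$ and $b_1,b_2,b_3$ are distinct vertices of $B_0$; if $e_3$ is any edge of $P(a_3,b_3)$, the graph is said to be of type $X$ with connectors $e_1,e_2,e_3$. *)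

theory Defs
  imports Main
begin

text \<open>Undirected simple graphs, finite or infinite. An edge is the set of its two end vertices, so
  there are neither loops nor multiple edges.\<close>

record 'a ugraph =
  verts :: "'a set"
  edges :: "'a set set"

definition simple_graph :: "'a ugraph \<Rightarrow> bool" where
  "simple_graph G \<longleftrightarrow> (\<forall>e\<in>edges G. e \<subseteq> verts G \<and> card e = 2)"

definition subgraph :: "'a ugraph \<Rightarrow> 'a ugraph \<Rightarrow> bool" where
  "subgraph H G \<longleftrightarrow> simple_graph H \<and> verts H \<subseteq> verts G \<and> edges H \<subseteq> edges G"

definition delete_verts :: "'a ugraph \<Rightarrow> 'a set \<Rightarrow> 'a ugraph" where
  "delete_verts G S = \<lparr>verts = verts G - S, edges = {e \<in> edges G. e \<inter> S = {}}\<rparr>"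

definition delete_edges :: "'a ugraph \<Rightarrow> 'a set set \<Rightarrow> 'a ugraph" where
  "delete_edges G F = \<lparr>verts = verts G, edges = edges G - F\<rparr>"

definition consecutive_edges :: "'a list \<Rightarrow> 'a set set" where
  "consecutive_edges p = {{p ! i, p ! Suc i} | i. Suc i < length p}"

text \<open>Paths and circuits are graphs in their own right; the list enumerates the vertices in order.
  A single vertex is a path from that vertex to itself.\<close>

definition is_path :: "'a ugraph \<Rightarrow> 'a \<Rightarrow> 'a \<Rightarrow> bool" where
  "is_path P u v \<longleftrightarrow> (\<exists>p. p \<noteq> [] \<and> distinct p \<and> hd p = u \<and> last p = v \<and>
     verts P = set p \<and> edges P = consecutive_edges p)"

definition is_circuit :: "'a ugraph \<Rightarrow> bool" where
  "is_circuit C \<longleftrightarrow> (\<exists>p. length p \<ge> 3 \<and> distinct p \<and>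
     verts C = set p \<and> edges C = insert {last p, hd p} (consecutive_edges p))"

definition connected_graph :: "'a ugraph \<Rightarrow> bool" where
  "connected_graph G \<longleftrightarrow> verts G \<noteq> {} \<and>
     (\<forall>u\<in>verts G. \<forall>v\<in>verts G. \<exists>P. subgraph P G \<and> is_path P u v)"

definition components :: "'a ugraph \<Rightarrow> 'a ugraph set" where
  "components G = {H. subgraph H G \<and> connected_graph H \<and>
     (\<forall>K. subgraph K G \<and> connected_graph K \<and> subgraph H K \<longrightarrow> K = H)}"

text \<open>The disjunct \<open>infinite (verts G)\<close> is needed because \<open>card\<close> is 0 on infinite sets.\<close>

definition k_connected :: "nat \<Rightarrow> 'a ugraph \<Rightarrow> bool" where
  "k_connected k G \<longleftrightarrow> (infinite (verts G) \<or> card (verts G) > k) \<and>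
     (\<forall>S. S \<subseteq> verts G \<and> finite S \<and> card S < k \<longrightarrow> connected_graph (delete_verts G S))"

definition type_X :: "'a ugraph \<Rightarrow> 'a set \<Rightarrow> 'a set \<Rightarrow> 'a set \<Rightarrow> bool" where
  "type_X H e1 e2 e3 \<longleftrightarrow> (\<exists>A0 B0 P a1 a2 a3 b1 b2 b3.
     is_circuit A0 \<and> is_circuit B0 \<and> verts A0 \<inter> verts B0 = {} \<and>
     {a1, a2, a3} \<subseteq> verts A0 \<and> distinct [a1, a2, a3] \<and>
     {b1, b2, b3} \<subseteq> verts B0 \<and> distinct [b1, b2, b3] \<and>
     e1 = {a1, b1} \<and> e2 = {a2, b2} \<and>
     is_path P a3 b3 \<and> verts P \<inter> (verts A0 \<union> verts B0) = {a3, b3} \<and> e3 \<in> edges P \<and>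
     verts H = verts A0 \<union> verts B0 \<union> verts P \<and>
     edges H = edges A0 \<union> edges B0 \<union> edges P \<union> {e1, e2})"

end

theory Submission imports Defs begin

text \<open>Write \<open>V1\<close> and \<open>V2\<close> for the vertex sets of \<open>G1\<close> and \<open>G2\<close>.

  If \<open>V1\<close> has a cut vertex \<open>c\<close>, let \<open>D\<close> be a component of \<open>V1 - {c}\<close> and \<open>R\<close> the union of the others.
  No vertex \<open>d\<close> of \<open>V2\<close> separates the neighbours of \<open>D\<close> from those of \<open>R\<close>, since \<open>{c, d}\<close> does not
  separate \<open>G\<close>. By Menger's theorem \<open>V2\<close> contains two disjoint paths between these neighbourhoods;
  joining their ends inside \<open>D\<close> and inside \<open>R \<union> {c}\<close> gives a circuit with four edges of \<open>A\<close>.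

  If neither side has a cut vertex and \<open>A\<close> has four edges, then on each side at least two of the three
  ways to pair their four ends are realised by disjoint paths. Choosing different pairings on the two
  sides closes up to a single circuit through all four edges.

  Otherwise \<open>A\<close> has exactly three edges. Each side has a circuit through the ends of the first two,
  and a path from the end of the third edge to that circuit avoiding these two ends; this is a
  graph of type \<open>X\<close>.\<close>

subsection \<open>Paths and two disjoint paths\<close>

definition wpath :: "('a \<Rightarrow> 'a \<Rightarrow> bool) \<Rightarrow> 'a set \<Rightarrow> 'a list \<Rightarrow> bool" where
  "wpath adj W p \<longleftrightarrow> p \<noteq> [] \<and> distinct p \<and> set p \<subseteq> W \<and> successively adj p"

text \<open>Connectedness by cuts rather than by paths: hypotheses about separators then directly
  yield an edge leaving a chosen set. The empty set counts as connected.\<close>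

definition connected_in :: "('a \<Rightarrow> 'a \<Rightarrow> bool) \<Rightarrow> 'a set \<Rightarrow> bool" where
  "connected_in adj W \<longleftrightarrow>
     (\<forall>X. X \<subseteq> W \<longrightarrow> X \<noteq> {} \<longrightarrow> X \<noteq> W \<longrightarrow> (\<exists>x\<in>X. \<exists>y\<in>W - X. adj x y))"

lemma connected_inD:
  assumes "connected_in adj W" "X \<subseteq> W" "x \<in> X" "y \<in> W - X"
  obtains u v where "u \<in> X" "v \<in> W - X" "adj u v"
  using assms unfolding connected_in_def by blast

lemma wpath_appendD: "wpath adj W (us @ p @ vs) \<Longrightarrow> p \<noteq> [] \<Longrightarrow> wpath adj W p"
  by (auto simp: wpath_def successively_append_iff)

lemma wpath_prefix: "wpath adj W (us @ z # vs) \<Longrightarrow> wpath adj W (us @ [z])"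
  by (auto simp: wpath_def successively_append_iff)

lemma wpath_join:
  assumes "wpath adj W (us @ [z])" "wpath adj W (z # vs)" "set us \<inter> set vs = {}"
  shows "wpath adj W (us @ z # vs)"
  using assms by (auto simp: wpath_def successively_append_iff)

lemma wpath_append:
  assumes "wpath adj W p" "wpath adj W q" "set p \<inter> set q = {}" "adj (last p) (hd q)"
  shows "wpath adj W (p @ q)"
  using assms by (auto simp: wpath_def successively_append_iff)

lemma wpath_mono: "wpath adj W p \<Longrightarrow> W \<subseteq> W' \<Longrightarrow> wpath adj W' p"
  by (auto simp: wpath_def)

lemma wpath_rev:
  assumes "\<And>x y. adj x y \<Longrightarrow> adj y x" "wpath adj W p"
  shows "wpath adj W (rev p)"
proof -
  have "successively (\<lambda>x y. adj y x) p"
    using assms by (auto simp: wpath_def intro: successively_mono)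
  then show ?thesis using assms(2) by (simp add: wpath_def)
qed

text \<open>The ends of paths in \<open>W\<close> starting in \<open>S\<close> form a set that no
  edge leaves within \<open>W\<close>, since such an edge would prolong a path; \<open>cut\<close>
  therefore forces this set to meet \<open>T\<close>.\<close>

lemma wpath_between_sets:
  assumes cut: "\<And>X. X \<subseteq> W \<Longrightarrow> S \<inter> W \<subseteq> X \<Longrightarrow> X \<inter> T = {} \<Longrightarrow> \<exists>x\<in>X. \<exists>y\<in>W - X. adj x y"
  obtains p where "wpath adj W p" "hd p \<in> S" "last p \<in> T"
proof -
  define X where "X = {last p | p. wpath adj W p \<and> hd p \<in> S}"
  have "X \<subseteq> W" unfolding X_def wpath_def by auto
  moreover have "S \<inter> W \<subseteq> X"
  proof
    fix x assume "x \<in> S \<inter> W"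
    then have "wpath adj W [x]" "hd [x] \<in> S" by (auto simp: wpath_def)
    then show "x \<in> X" unfolding X_def by force
  qed
  moreover have False if xy: "x \<in> X" "y \<in> W - X" "adj x y" for x y
  proof -
    obtain p where p: "wpath adj W p" "hd p \<in> S" "last p = x"
      using xy(1) unfolding X_def by blast
    have "y \<notin> set p"
    proof
      assume "y \<in> set p"
      then obtain us vs where "p = us @ y # vs" by (meson split_list)
      then have "wpath adj W (us @ [y])" "hd (us @ [y]) \<in> S"
        using p wpath_prefix by (fastforce, cases us, auto)
      then have "y \<in> X" unfolding X_def by force
      then show False using that by simp
    qed
    then have "wpath adj W (p @ [y])" "hd (p @ [y]) \<in> S"
      using p that by (auto simp: wpath_def successively_append_iff)
    then have "y \<in> X" unfolding X_def by force
    then show False using that by simp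
  qed
  ultimately have "X \<inter> T \<noteq> {}" using cut[of X] by metis
  then obtain x where "x \<in> X" "x \<in> T" by blast
  then show thesis using that unfolding X_def by blast
qed

lemma connected_in_wpath:
  assumes "connected_in adj W" "x \<in> W" "y \<in> W"
  obtains p where "wpath adj W p" "hd p = x" "last p = y"
proof -
  obtain p where "wpath adj W p" "hd p \<in> {x}" "last p \<in> {y}"
  proof (rule wpath_between_sets)
    show "\<exists>u\<in>X. \<exists>v\<in>W - X. adj u v" if "X \<subseteq> W" "{x} \<inter> W \<subseteq> X" "X \<inter> {y} = {}" for X
      using assms that unfolding connected_in_def by blast
  qed
  then show thesis using that by auto
qed

lemma wpath_connected_in:
  assumes "\<And>x y. x \<in> W \<Longrightarrow> y \<in> W \<Longrightarrow> \<exists>p. wpath adj W p \<and> hd p = x \<and> last p = y"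
  shows "connected_in adj W"
  unfolding connected_in_def
proof (intro allI impI)
  fix X assume X: "X \<subseteq> W" "X \<noteq> {}" "X \<noteq> W"
  then obtain x y where xy: "x \<in> X" "y \<in> W - X" by blast
  then obtain p where p: "wpath adj W p" "hd p = x" "last p = y" using assms X by blast
  have "successively adj p \<Longrightarrow> set p \<subseteq> W \<Longrightarrow> p \<noteq> [] \<Longrightarrow> hd p \<in> X \<Longrightarrow> last p \<notin> X
    \<Longrightarrow> \<exists>x\<in>X. \<exists>y\<in>W - X. adj x y"
    by (induction adj p rule: successively.induct) auto
  then show "\<exists>x\<in>X. \<exists>y\<in>W - X. adj x y" using p xy by (auto simp: wpath_def)
qed

text \<open>For a set containing \<open>c\<close>, an edge leaving its complement, read backwards by
  symmetry, leaves the set itself.\<close>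

lemma connected_in_pointed:
  assumes sym: "\<And>x y. adj x y \<Longrightarrow> adj y x"
    and cut: "\<And>X. X \<subseteq> W - {c} \<Longrightarrow> X \<noteq> {} \<Longrightarrow> \<exists>x\<in>X. \<exists>y\<in>W - X. adj x y"
  shows "connected_in adj W"
  unfolding connected_in_def
proof (intro allI impI)
  fix X assume X: "X \<subseteq> W" "X \<noteq> {}" "X \<noteq> W"
  show "\<exists>x\<in>X. \<exists>y\<in>W - X. adj x y"
  proof (cases "c \<in> X")
    case True
    then obtain x y where "x \<in> W - X" "y \<in> W - (W - X)" "adj x y"
      using cut[of "W - X"] X by blast
    then show ?thesis using sym X by blast
  next
    case False
    then show ?thesis using cut[of X] X by blast
  qed
qed

lemma connected_in_mono:
  assumes "connected_in adj W" "\<And>x y. adj x y \<Longrightarrow> adj' x y"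
  shows "connected_in adj' W"
  using assms unfolding connected_in_def by meson

text \<open>A set that no edge leaves contains or misses each of the two parts entirely, and the
  common vertex \<open>x\<close> forces the same alternative for both.\<close>

lemma connected_in_Un:
  assumes W: "connected_in adj W" and W': "connected_in adj W'" and x: "x \<in> W" "x \<in> W'"
  shows "connected_in adj (W \<union> W')"
  unfolding connected_in_def
proof (intro allI impI, rule ccontr)
  fix X assume X: "X \<subseteq> W \<union> W'" "X \<noteq> {}" "X \<noteq> W \<union> W'"
    and n: "\<not> (\<exists>x\<in>X. \<exists>y\<in>W \<union> W' - X. adj x y)"
  have "X \<inter> W = {} \<or> X \<inter> W = W" 
  proof (rule ccontr)
    assume "\<not> ?thesis"
    then have "\<exists>x\<in>X \<inter> W. \<exists>y\<in>W - X \<inter> W. adj x y" using W unfolding connected_in_def by auto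
    then show False using n by blast
  qed
  moreover have "X \<inter> W' = {} \<or> X \<inter> W' = W'"
  proof (rule ccontr)
    assume "\<not> ?thesis"
    then have "\<exists>x\<in>X \<inter> W'. \<exists>y\<in>W' - X \<inter> W'. adj x y" using W' unfolding connected_in_def by auto
    then show False using n by blast
  qed
  ultimately show False using X x by blast
qed

section \<open>Menger's theorem for two disjoint paths\<close>

text \<open>Cut \<open>r\<close> at its first vertex in \<open>T\<close>, then at the last vertex of
  \<open>Z\<close> up to there. If that vertex already lies in \<open>T\<close>, then
  \<open>v\<close> is empty.\<close>

lemma trim_list:
  assumes "r \<noteq> []" "hd r \<in> Z" "last r \<in> T"
  obtains us z v ws where "r = us @ (z # v) @ ws" "z \<in> Z" "last (z # v) \<in> T"
    "set v \<inter> Z = {}" "set (butlast (z # v)) \<inter> T = {}"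
proof -
  have "\<exists>x\<in>set r. x \<in> T" using assms last_in_set by blast
  then obtain u1 t v1 where 1: "r = u1 @ t # v1" "t \<in> T" "\<forall>x\<in>set u1. x \<notin> T"
    using split_list_first_prop[of r "\<lambda>x. x \<in> T"] by blast
  have "hd (u1 @ [t]) \<in> set (u1 @ [t])" by (rule hd_in_set) simp
  moreover have "hd (u1 @ [t]) = hd r" using 1 by (cases u1) auto
  ultimately have "\<exists>x\<in>set (u1 @ [t]). x \<in> Z" using assms(2) by metis
  then obtain u2 z v2 where 2: "u1 @ [t] = u2 @ z # v2" "z \<in> Z" "\<forall>x\<in>set v2. x \<notin> Z"
    using split_list_last_prop[of "u1 @ [t]" "\<lambda>x. x \<in> Z"] by blast
  have "r = u2 @ (z # v2) @ v1" using 1 2(1)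
    by (metis append.assoc append_Cons append_Nil)
  moreover have "last (z # v2) = t" using 2(1) by (metis last_appendR last_snoc list.distinct(1))
  moreover have "u1 = u2 @ butlast (z # v2)"
    using 2(1) by (metis butlast_append butlast_snoc list.distinct(1))
  ultimately have "last (z # v2) \<in> T" "set (butlast (z # v2)) \<inter> T = {}" "set v2 \<inter> Z = {}"
    using 1 2 by auto
  with \<open>r = u2 @ (z # v2) @ v1\<close> 2(2) show thesis by (intro that)
qed

text \<open>The state of the augmentation: \<open>ys @ [y]\<close> and \<open>xs @ [y]\<close> are paths from \<open>S\<close> that meet
  only in \<open>y\<close>, and \<open>y # ps\<close> leads on to \<open>T\<close>. A path avoiding \<open>y\<close> is trimmed to an ear that
  leaves \<open>S \<union> set xs \<union> set ys\<close> and ends in \<open>T\<close> or further along \<open>ps\<close>; in the latter case the new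
  state has a shorter \<open>ps\<close>. The degenerate case \<open>xs = ys = []\<close> starts the induction.\<close>

lemma augment_disjoint_paths:
  assumes avoid: "\<And>d. d \<in> W \<Longrightarrow> \<exists>r. wpath adj (W - {d}) r \<and> hd r \<in> S \<and> last r \<in> T"
    and "wpath adj W (ys @ y # ps)" "hd (ys @ [y]) \<in> S" "last (y # ps) \<in> T"
    and "xs = [] \<and> ys = [] \<or> xs \<noteq> [] \<and> hd xs \<in> S \<and> wpath adj W (xs @ [y])"
    and "set xs \<inter> set (ys @ y # ps) = {}"
  shows "\<exists>p q. wpath adj W p \<and> wpath adj W q \<and> set p \<inter> set q = {} \<and>
    hd p \<in> S \<and> hd q \<in> S \<and> last p \<in> T \<and> last q \<in> T"
  using assms(2-)
proof (induction ps arbitrary: xs ys y rule: length_induct)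
  case (1 ps)
  note Y = 1(2) and hdY = 1(3) and lastT = 1(4) and X = 1(5) and disj = 1(6)
  have "y \<in> W" using Y by (auto simp: wpath_def)
  then obtain r where r: "wpath adj (W - {y}) r" "hd r \<in> S" "last r \<in> T" using avoid by blast
  then have "r \<noteq> []" "hd r \<in> S \<union> set xs \<union> set ys" "last r \<in> T \<union> set ps"
    by (auto simp: wpath_def)
  then obtain us z v ws where *: "r = us @ (z # v) @ ws" "z \<in> S \<union> set xs \<union> set ys"
    "last (z # v) \<in> T \<union> set ps" "set v \<inter> (S \<union> set xs \<union> set ys) = {}"
    "set (butlast (z # v)) \<inter> (T \<union> set ps) = {}"
    by (rule trim_list)
  have zv': "wpath adj (W - {y}) (z # v)" using r(1) *(1) wpath_appendD by blast
  then have zv: "wpath adj W (z # v)" "y \<notin> set (z # v)"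
    by (auto simp: wpath_def)
  have Yy: "wpath adj W (ys @ [y])" using wpath_prefix[OF Y] .
  have yps: "wpath adj W (y # ps)" using Y wpath_appendD[of adj W ys "y # ps" "[]"] by simp
  have dY: "set ys \<inter> set ps = {}" "y \<notin> set ps" "y \<notin> set ys" using Y by (auto simp: wpath_def)
  \<comment> \<open>The ear starts on one of the two paths or afresh in \<open>S\<close>. Prolonged
    backwards to \<open>S\<close> it becomes \<open>zs @ z # v\<close>; a path among
    \<open>ys\<close> and \<open>xs\<close> that it does not use serves as \<open>xs'\<close> and
    reaches \<open>y\<close>.\<close>
  have "\<exists>zs xs'. wpath adj W (zs @ z # v) \<and> hd (zs @ [z]) \<in> S \<and> wpath adj W (xs' @ y # ps) \<and>
    hd (xs' @ [y]) \<in> S \<and> set (zs @ z # v) \<inter> set (xs' @ [y]) = {} \<and> set zs \<inter> set ps = {}"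
  proof -
    consider "z \<in> set xs" | "z \<in> set ys" "z \<notin> set xs" | "z \<in> S" "z \<notin> set xs" "z \<notin> set ys"
      using * by blast
    then show ?thesis
    proof cases
      case 1
      then obtain x1 x2 where x: "xs = x1 @ z # x2" by (meson split_list)
      have "wpath adj W (x1 @ z # x2 @ [y])" using X x by auto
      then have "wpath adj W (x1 @ [z])" by (rule wpath_prefix)
      then have "wpath adj W (x1 @ z # v)" by (rule wpath_join) (use zv * x in auto)
      moreover have "hd (x1 @ [z]) \<in> S" using X x by (cases x1) auto
      ultimately show ?thesis using Y hdY zv * x disj dY
        by (intro exI[of _ x1] exI[of _ ys]) auto
    next
      case 2
      then obtain y1 y2 where x: "ys = y1 @ z # y2" by (meson split_list)
      then have xs: "xs \<noteq> []" "hd xs \<in> S" "wpath adj W (xs @ [y])" using X by auto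
      have "wpath adj W (y1 @ z # y2 @ y # ps)" using Y x by auto
      then have "wpath adj W (y1 @ [z])" by (rule wpath_prefix)
      then have "wpath adj W (y1 @ z # v)" by (rule wpath_join) (use zv * x in auto)
      moreover have "hd (y1 @ [z]) \<in> S" using hdY x by (cases y1) auto
      moreover have "wpath adj W (xs @ y # ps)" using xs(3) yps by (rule wpath_join) (use disj in auto)
      ultimately show ?thesis using xs zv * x disj dY
        by (intro exI[of _ y1] exI[of _ xs]) auto
    next
      case 3
      then show ?thesis using zv Y hdY *
        by (intro exI[of _ "[]"] exI[of _ ys]) auto
    qed
  qed
  then obtain zs xs' where Y': "wpath adj W (zs @ z # v)" "hd (zs @ [z]) \<in> S"
    and X': "wpath adj W (xs' @ y # ps)" "hd (xs' @ [y]) \<in> S"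
    and d: "set (zs @ z # v) \<inter> set (xs' @ [y]) = {}" "set zs \<inter> set ps = {}" by blast
  obtain v0 t where v0: "z # v = v0 @ [t]" by (metis list.distinct(1) rev_exhaust)
  then have t: "last (z # v) = t" "butlast (z # v) = v0" by simp_all
  have hdY': "hd (zs @ z # v) \<in> S" using Y'(2) by (cases zs) auto
  have hdX': "hd (xs' @ y # q) \<in> S" for q using X'(2) by (cases xs') auto
  show ?case
  proof (cases "t \<in> set ps")
    case False
    then have "set (zs @ z # v) \<inter> set (xs' @ y # ps) = {}" using d * t v0 by auto
    then show ?thesis using Y' X' hdY' hdX' lastT * t False
      by (intro exI[of _ "zs @ z # v"] exI[of _ "xs' @ y # ps"]) auto
  next
    case True
    \<comment> \<open>The ear meets the old tail at \<open>t\<close>: the new state consists of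
      \<open>zs @ v0\<close> and \<open>xs' @ y # p1\<close>, meeting in \<open>t\<close>, with the
      shorter remainder \<open>p2\<close>.\<close>
    then obtain p1 p2 where ps: "ps = p1 @ t # p2" by (meson split_list)
    have "wpath adj W (((zs @ v0)) @ t # p2)"
    proof (rule wpath_join)
      show "wpath adj W ((zs @ v0) @ [t])" using Y' v0 by simp
      show "wpath adj W (t # p2)" using X' ps wpath_appendD[of adj W "xs' @ y # p1" "t # p2" "[]"] by simp
      show "set (zs @ v0) \<inter> set p2 = {}" using d ps * t by auto
    qed
    moreover have "hd ((zs @ v0) @ [t]) \<in> S" using hdY' v0 by simp
    moreover have "last (t # p2) \<in> T" using lastT ps by simp
    moreover have "wpath adj W ((xs' @ y # p1) @ [t])"
      using X'(1) ps wpath_prefix[of adj W "xs' @ y # p1" t p2] by simp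
    moreover have "set (xs' @ y # p1) \<inter> set ((zs @ v0) @ t # p2) = {}"
    proof -
      have "set (xs' @ y # p1) \<inter> set (t # p2) = {}" using X'(1) ps by (auto simp: wpath_def)
      moreover have "set p1 \<inter> set (zs @ v0) = {}" using d ps * t by auto
      moreover have "set (xs' @ [y]) \<inter> set (zs @ v0) = {}" using d(1) v0 by auto
      ultimately show ?thesis by auto
    qed
    moreover have "length p2 < length ps" using ps by simp
    ultimately show ?thesis using 1(1) hdX' by blast
  qed
qed

text \<open>\<open>cut\<close> expresses that no single vertex separates \<open>S\<close> from
  \<open>T\<close>, in the form of leaving edges that \<open>connected_inD\<close> supplies.\<close>

lemma two_disjoint_paths:
  assumes "W \<noteq> {}"
    and cut: "\<And>d X. d \<in> W \<Longrightarrow> X \<subseteq> W - {d} \<Longrightarrow> S \<inter> (W - {d}) \<subseteq> X \<Longrightarrow> X \<inter> T = {}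
      \<Longrightarrow> \<exists>x\<in>X. \<exists>y\<in>W - {d} - X. adj x y"
  obtains p q where "wpath adj W p" "wpath adj W q" "set p \<inter> set q = {}"
    "hd p \<in> S" "hd q \<in> S" "last p \<in> T" "last q \<in> T"
proof -
  have avoid: "\<exists>r. wpath adj (W - {d}) r \<and> hd r \<in> S \<and> last r \<in> T" if "d \<in> W" for d
    using wpath_between_sets[of "W - {d}" S T adj] cut[OF that] by metis
  \<comment> \<open>Any vertex of \<open>W\<close> may be taken for \<open>d\<close> here; the path
    obtained starts the augmentation with \<open>xs\<close> and \<open>ys\<close> empty.\<close>
  obtain r where r: "wpath adj W r" "hd r \<in> S" "last r \<in> T"
    using assms(1) avoid by (meson Diff_subset ex_in_conv wpath_mono)
  then obtain y ps where "r = y # ps" by (cases r) (auto simp: wpath_def)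
  then show thesis
    using augment_disjoint_paths[OF avoid, of "[]" y ps "[]"] r that by auto
qed

subsection \<open>Circuits and linkages\<close>

lemma consecutive_edges_simps [simp]:
  "consecutive_edges [] = {}" "consecutive_edges [x] = {}"
  by (auto simp: consecutive_edges_def)

lemma consecutive_edges_Cons [simp]:
  "consecutive_edges (x # y # p) = insert {x, y} (consecutive_edges (y # p))"
proof -
  have "e \<in> consecutive_edges (x # y # p) \<longleftrightarrow> e \<in> insert {x, y} (consecutive_edges (y # p))" for e
  proof
    assume "e \<in> consecutive_edges (x # y # p)"
    then obtain i where i: "e = {(x # y # p) ! i, (x # y # p) ! Suc i}" "Suc i < length (x # y # p)"
      unfolding consecutive_edges_def by blast
    then show "e \<in> insert {x, y} (consecutive_edges (y # p))"
      by (cases i) (auto simp: consecutive_edges_def)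
  next
    assume "e \<in> insert {x, y} (consecutive_edges (y # p))"
    then consider "e = {x, y}"
      | i where "e = {(y # p) ! i, (y # p) ! Suc i}" "Suc i < length (y # p)"
      unfolding consecutive_edges_def by blast
    then show "e \<in> consecutive_edges (x # y # p)"
    proof cases
      case 1
      then show ?thesis unfolding consecutive_edges_def by (intro CollectI exI[of _ 0]) simp
    next
      case (2 i)
      then show ?thesis unfolding consecutive_edges_def by (intro CollectI exI[of _ "Suc i"]) simp
    qed
  qed
  then show ?thesis by blast
qed

lemma consecutive_edges_append:
  "p \<noteq> [] \<Longrightarrow> q \<noteq> [] \<Longrightarrow>
    consecutive_edges (p @ q) = insert {last p, hd q} (consecutive_edges p \<union> consecutive_edges q)"
proof (induction p)
  case (Cons x p)
  then show ?case by (cases p; cases q) auto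
qed simp

lemma consecutive_edges_subset_iff:
  "consecutive_edges p \<subseteq> E \<longleftrightarrow> successively (\<lambda>x y. {x, y} \<in> E) p"
  by (induction "\<lambda>x y. {x, y} \<in> E" p rule: successively.induct) auto

lemma consecutive_edges_verts: "e \<in> consecutive_edges p \<Longrightarrow> e \<subseteq> set p"
  by (auto simp: consecutive_edges_def)

definition wcircuit :: "('a \<Rightarrow> 'a \<Rightarrow> bool) \<Rightarrow> 'a set \<Rightarrow> 'a list \<Rightarrow> bool" where
  "wcircuit adj W p \<longleftrightarrow> length p \<ge> 3 \<and> wpath adj W p \<and> adj (last p) (hd p)"

definition circuit_edges :: "'a list \<Rightarrow> 'a set set" where
  "circuit_edges p = insert {last p, hd p} (consecutive_edges p)"

definition linked :: "('a \<Rightarrow> 'a \<Rightarrow> bool) \<Rightarrow> 'a set \<Rightarrow> 'a \<Rightarrow> 'a \<Rightarrow> 'a \<Rightarrow> 'a \<Rightarrow> bool" where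
  "linked adj W a b c d \<longleftrightarrow> (\<exists>p q. wpath adj W p \<and> wpath adj W q \<and> set p \<inter> set q = {} \<and>
     hd p = a \<and> last p = b \<and> hd q = c \<and> last q = d)"

lemma linked_swap: "linked adj W a b c d \<Longrightarrow> linked adj W c d a b"
  unfolding linked_def by (metis inf_commute)

lemma linked_rev:
  assumes "\<And>x y. adj x y \<Longrightarrow> adj y x" "linked adj W a b c d"
  shows "linked adj W b a c d"
proof -
  obtain p q where *: "wpath adj W p" "wpath adj W q" "set p \<inter> set q = {}"
     "hd p = a" "last p = b" "hd q = c" "last q = d" using assms(2) unfolding linked_def by blast
  have "wpath adj W (rev p)" using assms(1) *(1) by (rule wpath_rev)
  moreover have "hd (rev p) = b" "last (rev p) = a" "set (rev p) \<inter> set q = {}"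
    using * by (auto simp: hd_rev last_rev)
  ultimately show ?thesis unfolding linked_def using * by blast
qed

subsection \<open>Two sides joined by a matching\<close>

text \<open>Abstracts from the edge set \<open>A\<close>: the edges between the two sides play its
  part, and \<open>match1\<close>, \<open>match2\<close> make them a matching. \<open>sep\<close>
  and \<open>big\<close> stand for 3-connectedness; in \<open>sep\<close> the vertices
  \<open>c\<close> and \<open>d\<close> may coincide, which covers the deletion of one
  vertex.\<close>

locale two_sided_cut =
  fixes adj :: "'a \<Rightarrow> 'a \<Rightarrow> bool" and V1 V2 :: "'a set"
  assumes sym: "adj x y \<Longrightarrow> adj y x"
    and disj: "V1 \<inter> V2 = {}"
    and nonempty1: "V1 \<noteq> {}" and nonempty2: "V2 \<noteq> {}"
    and conn1: "connected_in adj V1" and conn2: "connected_in adj V2"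
    and match1: "a \<in> V1 \<Longrightarrow> b \<in> V2 \<Longrightarrow> b' \<in> V2 \<Longrightarrow> adj a b \<Longrightarrow> adj a b' \<Longrightarrow> b = b'"
    and match2: "a \<in> V1 \<Longrightarrow> a' \<in> V1 \<Longrightarrow> b \<in> V2 \<Longrightarrow> adj a b \<Longrightarrow> adj a' b \<Longrightarrow> a = a'"
    and sep: "connected_in adj (V1 \<union> V2 - {c, d})"
    and big: "\<not> V1 \<union> V2 \<subseteq> {x, y, z}"
begin

lemma swapped: "two_sided_cut adj V2 V1"
proof
  show "a \<in> V2 \<Longrightarrow> b \<in> V1 \<Longrightarrow> b' \<in> V1 \<Longrightarrow> adj a b \<Longrightarrow> adj a b' \<Longrightarrow> b = b'" for a b b'
    using match2 sym by blast
  show "a \<in> V2 \<Longrightarrow> a' \<in> V2 \<Longrightarrow> b \<in> V1 \<Longrightarrow> adj a b \<Longrightarrow> adj a' b \<Longrightarrow> a = a'" for a a' b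
    using match1 sym by blast
qed (use sym disj nonempty1 nonempty2 conn1 conn2 sep big in \<open>auto simp: Un_commute\<close>)

section \<open>Circuits through four cross edges\<close>

definition four_cross_circuit :: bool where
  "four_cross_circuit \<longleftrightarrow> (\<exists>C a1 a2 a3 a4 b1 b2 b3 b4. wcircuit adj (V1 \<union> V2) C \<and>
     {a1, a2, a3, a4} \<subseteq> V1 \<and> {b1, b2, b3, b4} \<subseteq> V2 \<and> distinct [a1, a2, a3, a4] \<and>
     distinct [b1, b2, b3, b4] \<and> {{a1, b1}, {a2, b2}, {a3, b3}, {a4, b4}} \<subseteq> circuit_edges C)"

text \<open>The indices are shifted between the two linkages so that the paths chain as
  \<open>a1\<close> to \<open>a2\<close>, \<open>b2\<close> to \<open>b3\<close>, \<open>a3\<close>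
  to \<open>a4\<close>, \<open>b4\<close> to \<open>b1\<close> and close into one circuit rather
  than two.\<close>

lemma four_cross_circuitI:
  assumes "linked adj V1 a1 a2 a3 a4" "linked adj V2 b2 b3 b4 b1"
    and adj: "adj a1 b1" "adj a2 b2" "adj a3 b3" "adj a4 b4"
  shows four_cross_circuit
proof -
  obtain p q where p: "wpath adj V1 p" "wpath adj V1 q" "set p \<inter> set q = {}"
    "hd p = a1" "last p = a2" "hd q = a3" "last q = a4" using assms(1) unfolding linked_def by blast
  obtain r s where r: "wpath adj V2 r" "wpath adj V2 s" "set r \<inter> set s = {}"
    "hd r = b2" "last r = b3" "hd s = b4" "last s = b1" using assms(2) unfolding linked_def by blast
  have ne: "p \<noteq> []" "q \<noteq> []" "r \<noteq> []" "s \<noteq> []" and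
    sub: "set p \<subseteq> V1" "set q \<subseteq> V1" "set r \<subseteq> V2" "set s \<subseteq> V2"
    using p r by (auto simp: wpath_def)
  have mem: "a1 \<in> set p" "a2 \<in> set p" "a3 \<in> set q" "a4 \<in> set q"
    "b2 \<in> set r" "b3 \<in> set r" "b4 \<in> set s" "b1 \<in> set s"
    using p r ne hd_in_set last_in_set by metis+
  \<comment> \<open>The ends of one path could still coincide; disjointness of the paths and the
    matching property together rule this out.\<close>
  have neq: "a2 \<noteq> a3" "a1 \<noteq> a4" using mem p(3) by auto
  have b: "distinct [b1, b2, b3, b4]"
    using match2[of a2 a3 b2] match2[of a1 a4 b1] neq adj mem sub r(3) by auto
  have a: "distinct [a1, a2, a3, a4]"
    using match1[of a1 b1 b2] match1[of a1 b1 b3] match1[of a1 b1 b4] match1[of a2 b2 b3]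
      match1[of a2 b2 b4] match1[of a3 b3 b4] adj mem sub b by auto
  define C where "C = p @ r @ q @ s"
  have w: "wpath adj (V1 \<union> V2) t" if "t \<in> {p, q, r, s}" for t
    using that p r wpath_mono[of adj _ _ "V1 \<union> V2"] by blast
  have "wpath adj (V1 \<union> V2) (q @ s)"
    by (rule wpath_append) (use w p r sub disj adj in auto)
  then have "wpath adj (V1 \<union> V2) (r @ q @ s)"
    by (rule wpath_append[rotated]) (use w p r sub disj adj sym ne in auto)
  then have "wpath adj (V1 \<union> V2) C" unfolding C_def
    by (rule wpath_append[rotated]) (use w p r sub disj adj ne in auto)
  moreover have "adj (last C) (hd C)" using p r ne adj sym by (auto simp: C_def)
  moreover have "length C \<ge> 3" using ne by (cases p; cases q; cases r; cases s) (auto simp: C_def)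
  ultimately have "wcircuit adj (V1 \<union> V2) C" by (simp add: wcircuit_def)
  moreover have "{{a1, b1}, {a2, b2}, {a3, b3}, {a4, b4}} \<subseteq> circuit_edges C"
    using p r ne by (auto simp: circuit_edges_def C_def consecutive_edges_append insert_commute)
  moreover have "{a1, a2, a3, a4} \<subseteq> V1" "{b1, b2, b3, b4} \<subseteq> V2" using mem sub by auto
  ultimately show ?thesis using a b unfolding four_cross_circuit_def by blast
qed

text \<open>Only \<open>D\<close> has to be a single component: \<open>R\<close> may be
  disconnected, yet every part of it has an edge leaving it within \<open>V1\<close>, never to
  \<open>D\<close>, so \<open>R\<close> together with \<open>c\<close> is connected. This keeps the
  two connecting paths in \<open>V1\<close> disjoint.\<close>

lemma cutvertex_four_cross_circuit:
  assumes c: "c \<in> V1" and nc: "\<not> connected_in adj (V1 - {c})"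
  shows four_cross_circuit
proof -
  define W where "W = V1 - {c}"
  obtain X x where X: "X \<subseteq> W" "X \<noteq> W" "x \<in> X" "\<forall>u\<in>X. \<forall>v\<in>W - X. \<not> adj u v"
    using nc unfolding connected_in_def W_def by blast
  define closed where "closed Z \<longleftrightarrow> x \<in> Z \<and> Z \<subseteq> W \<and> (\<forall>u\<in>Z. \<forall>v\<in>W - Z. \<not> adj u v)" for Z
  \<comment> \<open>the component of \<open>x\<close> in \<open>V1 - {c}\<close>\<close>
  define D where "D = \<Inter> {Z. closed Z}"
  define R where "R = W - D"
  have "closed X" using X by (simp add: closed_def)
  then have DX: "D \<subseteq> X" by (auto simp: D_def)
  have "closed D" using \<open>closed X\<close> unfolding D_def closed_def by blast
  then have D: "x \<in> D" "D \<subseteq> W" and DR: "\<And>u v. u \<in> D \<Longrightarrow> v \<in> R \<Longrightarrow> \<not> adj u v"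
    by (auto simp: closed_def R_def)
  have Rne: "R \<noteq> {}" using X DX D by (auto simp: R_def)
  have connD: "connected_in adj D"
  proof (rule connected_in_pointed[where c = x])
    fix Y assume Y: "Y \<subseteq> D - {x}" "Y \<noteq> {}"
    show "\<exists>u\<in>Y. \<exists>v\<in>D - Y. adj u v"
    proof (rule ccontr)
      assume n: "\<not> ?thesis"
      \<comment> \<open>Without an edge from \<open>Y\<close> to \<open>D - Y\<close>, removing
        \<open>Y\<close> leaves a smaller closed set containing \<open>x\<close>, against the
        minimality of \<open>D\<close>.\<close>
      have "\<not> adj u v" if "u \<in> D - Y" "v \<in> W - (D - Y)" for u v
        using that n DR[of u v] sym[of u v] by (auto simp: R_def)
      then have "closed (D - Y)" using Y D by (auto simp: closed_def)
      then have "D \<subseteq> D - Y" unfolding D_def by blast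
      then show False using Y by blast
    qed
  qed (rule sym)
  have connR: "connected_in adj (insert c R)"
  proof (rule connected_in_pointed[where c = c])
    fix Y assume Y: "Y \<subseteq> insert c R - {c}" "Y \<noteq> {}"
    then have YR: "Y \<subseteq> R" by auto
    then have "Y \<subseteq> V1" "c \<in> V1 - Y" using c by (auto simp: R_def W_def)
    then obtain u v where uv: "u \<in> Y" "v \<in> V1 - Y" "adj u v"
      using connected_inD[OF conn1] Y(2) by blast
    have "v \<notin> D" using uv YR DR sym by blast
    then have "v \<in> insert c R - Y" using uv by (auto simp: R_def W_def)
    then show "\<exists>u\<in>Y. \<exists>v\<in>insert c R - Y. adj u v" using uv by blast
  qed (rule sym)
  define S where "S = {b \<in> V2. \<exists>a\<in>D. adj a b}"
  define T where "T = {b \<in> V2. \<exists>a\<in>R. adj a b}"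
  have sub: "D \<subseteq> V1" "R \<subseteq> V1" "c \<notin> D" "c \<notin> R" "D \<inter> R = {}" "V1 = insert c (D \<union> R)"
    using D c by (auto simp: W_def R_def)
  obtain p q where pq: "wpath adj V2 p" "wpath adj V2 q" "set p \<inter> set q = {}"
    "hd p \<in> S" "hd q \<in> S" "last p \<in> T" "last q \<in> T"
  proof (rule two_disjoint_paths)
    fix d X assume d: "d \<in> V2" and X: "X \<subseteq> V2 - {d}" "S \<inter> (V2 - {d}) \<subseteq> X" "X \<inter> T = {}"
    obtain y where y: "y \<in> R" using Rne by blast
    have 1: "D \<union> X \<subseteq> V1 \<union> V2 - {c, d}" using X sub d disj by blast
    have 2: "x \<in> D \<union> X" using D by blast
    have 3: "y \<in> V1 \<union> V2 - {c, d} - (D \<union> X)" using y X sub d disj by blast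
    \<comment> \<open>This edge cannot start in \<open>D\<close>, as \<open>S\<close> apart from
      \<open>d\<close> lies in \<open>X\<close> and \<open>D\<close> has no edge to
      \<open>R\<close>; it cannot end in \<open>R\<close>, as \<open>X\<close> misses
      \<open>T\<close>. Hence it runs inside \<open>V2\<close>.\<close>
    obtain u v where uv: "u \<in> D \<union> X" "v \<in> V1 \<union> V2 - {c, d} - (D \<union> X)" "adj u v"
      using connected_inD[OF sep 1 2 3] by blast
    have "v \<in> V2 - {d} - X \<or> v \<in> R" using uv sub by blast
    moreover have "u \<notin> D" using uv DR X sub by (auto simp: S_def)
    moreover have "v \<notin> R"
    proof
      assume "v \<in> R"
      then have "u \<in> T" using uv \<open>u \<notin> D\<close> X(1) sym[of u v] by (auto simp: T_def)
      then show False using uv \<open>u \<notin> D\<close> X(3) by blast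
    qed
    ultimately show "\<exists>x\<in>X. \<exists>y\<in>V2 - {d} - X. adj x y" using uv by blast
  qed (rule nonempty2)
  obtain a1 where a1: "a1 \<in> D" "adj a1 (hd p)" using pq unfolding S_def by blast
  obtain a2 where a2: "a2 \<in> D" "adj a2 (hd q)" using pq unfolding S_def by blast
  obtain a3 where a3: "a3 \<in> R" "adj a3 (last q)" using pq unfolding T_def by blast
  obtain a4 where a4: "a4 \<in> R" "adj a4 (last p)" using pq unfolding T_def by blast
  obtain u where u: "wpath adj D u" "hd u = a1" "last u = a2"
    using connected_in_wpath[OF connD a1(1) a2(1)] by blast
  obtain w where w: "wpath adj (insert c R) w" "hd w = a3" "last w = a4"
    using connected_in_wpath[OF connR] a3(1) a4(1) by blast
  have "set u \<subseteq> D" "set w \<subseteq> insert c R" using u w by (auto simp: wpath_def)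
  then have "set u \<inter> set w = {}" using sub by blast
  moreover have "wpath adj V1 u" "wpath adj V1 w"
    using u w sub by (auto elim!: wpath_mono)
  ultimately have "linked adj V1 a1 a2 a3 a4" using u w unfolding linked_def by blast
  \<comment> \<open>The ends of \<open>p\<close> play \<open>b1\<close> and \<open>b4\<close>, those
    of \<open>q\<close> play \<open>b2\<close> and \<open>b3\<close>, so \<open>p\<close> is
    traversed backwards.\<close>
  moreover have "linked adj V2 (hd q) (last q) (last p) (hd p)"
  proof (rule linked_swap, rule linked_rev)
    show "linked adj V2 (hd p) (last p) (hd q) (last q)" using pq unfolding linked_def by blast
  qed (rule sym)
  ultimately show ?thesis using four_cross_circuitI a1 a2 a3 a4 by blast
qed

text \<open>Menger's theorem does not determine which of the two pairings across \<open>{a, b}\<close> and \<open>{c, d}\<close>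
  is realised. Applied to all three partitions of four vertices into two pairs, it still shows
  that at least two of the three pairings are linked.\<close>

lemma linked_pairs:
  assumes nc: "\<And>c. c \<in> V1 \<Longrightarrow> connected_in adj (V1 - {c})"
    and a: "{a, b, c, d} \<subseteq> V1" "distinct [a, b, c, d]"
  shows "linked adj V1 a c b d \<or> linked adj V1 a d b c"
proof -
  obtain p q where pq: "wpath adj V1 p" "wpath adj V1 q" "set p \<inter> set q = {}"
    "hd p \<in> {a, b}" "hd q \<in> {a, b}" "last p \<in> {c, d}" "last q \<in> {c, d}"
  proof (rule two_disjoint_paths)
    fix e X assume e: "e \<in> V1" and X: "X \<subseteq> V1 - {e}" "{a, b} \<inter> (V1 - {e}) \<subseteq> X" "X \<inter> {c, d} = {}"
    obtain x where "x \<in> {a, b} - {e}" using a by auto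
    moreover obtain y where "y \<in> {c, d} - {e}" using a by auto
    ultimately have "x \<in> X" "y \<in> V1 - {e} - X" using X a by auto
    then show "\<exists>x\<in>X. \<exists>y\<in>V1 - {e} - X. adj x y"
      using connected_inD[OF nc[OF e] X(1)] by metis
  qed (use a in auto)
  have "hd p \<noteq> hd q" "last p \<noteq> last q" using pq hd_in_set last_in_set
    unfolding wpath_def by (metis disjoint_iff)+
  then have "hd p = a \<and> hd q = b \<or> hd p = b \<and> hd q = a"
    "last p = c \<and> last q = d \<or> last p = d \<and> last q = c" using pq by auto
  moreover have "linked adj V1 (hd p) (last p) (hd q) (last q)"
    using pq unfolding linked_def by blast
  ultimately show ?thesis using linked_swap by metis
qed

lemma four_cross_of_four_edges:
  assumes nc1: "\<And>c. c \<in> V1 \<Longrightarrow> connected_in adj (V1 - {c})"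
    and nc2: "\<And>c. c \<in> V2 \<Longrightarrow> connected_in adj (V2 - {c})"
    and a: "{a1, a2, a3, a4} \<subseteq> V1" "distinct [a1, a2, a3, a4]" and b: "{b1, b2, b3, b4} \<subseteq> V2"
    and adj: "adj a1 b1" "adj a2 b2" "adj a3 b3" "adj a4 b4"
  shows four_cross_circuit
proof -
  interpret sw: two_sided_cut adj V2 V1 by (rule swapped)
  have db: "distinct [b1, b2, b3, b4]" using match2 a b adj by auto
  \<comment> \<open>Each of these instances puts a different pairing aside and links one of the
    other two; together they link at least two of the three.\<close>
  have p1: "linked adj V1 a1 a3 a2 a4 \<or> linked adj V1 a1 a4 a2 a3"
    using linked_pairs[OF nc1] a by simp
  have p2: "linked adj V1 a1 a2 a3 a4 \<or> linked adj V1 a1 a4 a3 a2"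
    using linked_pairs[OF nc1, of a1 a3 a2 a4] a by auto
  have p3: "linked adj V1 a1 a2 a4 a3 \<or> linked adj V1 a1 a3 a4 a2"
    using linked_pairs[OF nc1, of a1 a4 a2 a3] a by auto
  have q1: "linked adj V2 b1 b3 b2 b4 \<or> linked adj V2 b1 b4 b2 b3"
    using sw.linked_pairs[OF nc2] b db by simp
  have q2: "linked adj V2 b1 b2 b3 b4 \<or> linked adj V2 b1 b4 b3 b2"
    using sw.linked_pairs[OF nc2, of b1 b3 b2 b4] b db by auto
  have q3: "linked adj V2 b1 b2 b4 b3 \<or> linked adj V2 b1 b3 b4 b2"
    using sw.linked_pairs[OF nc2, of b1 b4 b2 b3] b db by auto
  have r: "linked adj W x y z w \<longleftrightarrow> linked adj W y x z w" for W x y z w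
    using linked_rev sym by metis
  have s: "linked adj W x y z w \<longleftrightarrow> linked adj W z w x y" for W x y z w
    using linked_swap by metis
  have t: "linked adj W x y z w \<longleftrightarrow> linked adj W x y w z" for W x y z w
    using r s by metis
  \<comment> \<open>The six choices of different pairings on the two sides. In each case the indices
    are permuted to fit the shifted form of \<open>four_cross_circuitI\<close>.\<close>
  consider "linked adj V1 a1 a2 a3 a4" "linked adj V2 b1 b3 b2 b4"
    | "linked adj V1 a1 a2 a3 a4" "linked adj V2 b1 b4 b2 b3"
    | "linked adj V1 a1 a3 a2 a4" "linked adj V2 b1 b2 b3 b4"
    | "linked adj V1 a1 a3 a2 a4" "linked adj V2 b1 b4 b2 b3"
    | "linked adj V1 a1 a4 a2 a3" "linked adj V2 b1 b2 b3 b4"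
    | "linked adj V1 a1 a4 a2 a3" "linked adj V2 b1 b3 b2 b4"
    using p1 p2 p3 q1 q2 q3 t by metis
  then show ?thesis
  proof cases
    case 1
    then have "linked adj V1 a2 a1 a3 a4" "linked adj V2 b1 b3 b4 b2" using r t by metis+
    then show ?thesis using adj by (intro four_cross_circuitI)
  next
    case 2
    then have "linked adj V1 a1 a2 a3 a4" "linked adj V2 b2 b3 b4 b1" using r s t by metis+
    then show ?thesis using adj by (intro four_cross_circuitI)
  next
    case 3
    then have "linked adj V1 a3 a1 a2 a4" "linked adj V2 b1 b2 b4 b3" using r t by metis+
    then show ?thesis using adj by (intro four_cross_circuitI)
  next
    case 4
    then have "linked adj V1 a1 a3 a2 a4" "linked adj V2 b3 b2 b4 b1" using r s t by metis+
    then show ?thesis using adj by (intro four_cross_circuitI)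
  next
    case 5
    then have "linked adj V1 a4 a1 a2 a3" "linked adj V2 b1 b2 b3 b4" using r t by metis+
    then show ?thesis using adj by (intro four_cross_circuitI)
  next
    case 6
    then have "linked adj V1 a4 a1 a3 a2" "linked adj V2 b1 b3 b2 b4" using r t by metis+
    then show ?thesis using adj by (intro four_cross_circuitI)
  qed
qed

section \<open>Three cross edges, and circuits with tails on each side\<close>

text \<open>After deletion of \<open>c\<close> and \<open>d\<close> the rest of \<open>V1\<close> is
  still joined to \<open>V2\<close>. If nothing of \<open>V1\<close> is left, \<open>c\<close> has
  at most one neighbour in \<open>V2\<close>; deleting it, and the other vertex of \<open>V1\<close>
  if there is one, would isolate \<open>c\<close> although further vertices remain. Taking
  \<open>c = d\<close> avoids a single vertex.\<close>

lemma cross_edge_avoiding: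
  assumes c: "c \<in> V1" and d: "d \<in> V1"
  obtains a b where "a \<in> V1 - {c, d}" "b \<in> V2" "adj a b"
proof (cases "V1 \<subseteq> {c, d}")
  case False
  then obtain x where x: "x \<in> V1 - {c, d}" by blast
  obtain y where y: "y \<in> V2" using nonempty2 by blast
  have 1: "V1 - {c, d} \<subseteq> V1 \<union> V2 - {c, d}" by blast
  have 2: "y \<in> V1 \<union> V2 - {c, d} - (V1 - {c, d})" using y c d disj by blast
  obtain u v where "u \<in> V1 - {c, d}" "v \<in> V1 \<union> V2 - {c, d} - (V1 - {c, d})" "adj u v"
    using connected_inD[OF sep 1 x 2] by blast
  then show thesis using that[of u v] by blast
next
  case True
  \<comment> \<open>If \<open>c\<close> has no neighbour in \<open>V2\<close>, then \<open>b\<close>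
    is an arbitrary vertex of \<open>V2\<close>.\<close>
  obtain b where b: "b \<in> V2" "\<And>b'. b' \<in> V2 \<Longrightarrow> adj c b' \<Longrightarrow> b' = b"
    using match1[OF c] nonempty2 by (metis ex_in_conv)
  \<comment> \<open>When \<open>d = c\<close>, taking \<open>b\<close> for \<open>e\<close> keeps
    \<open>c\<close> itself from being deleted.\<close>
  define e where "e = (if d = c then b else d)"
  have ce: "c \<noteq> b" "c \<noteq> e" "V1 \<subseteq> {c, e}"
    using b c disj True by (auto simp: e_def)
  obtain y where "y \<in> V1 \<union> V2 - {b, e} - {c}" using big[of b e c] by blast
  moreover have "{c} \<subseteq> V1 \<union> V2 - {b, e}" using c ce by blast
  ultimately obtain v where "v \<in> V1 \<union> V2 - {b, e} - {c}" "adj c v"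
    using connected_inD[OF sep, of "{c}"] by (metis singletonD singletonI)
  then have False using b ce by blast
  then show thesis ..
qed

text \<open>If \<open>a1\<close> and \<open>a2\<close> are adjacent, deleting \<open>a2\<close> and
  \<open>b1\<close> leaves \<open>a1\<close> a further neighbour \<open>w\<close>, in
  \<open>V1\<close> by the matching property, and a path from \<open>w\<close> to \<open>a2\<close>
  avoiding \<open>a1\<close> closes up. Otherwise Menger's theorem gives two disjoint paths between
  the neighbourhoods of \<open>a1\<close> and \<open>a2\<close>.\<close>

lemma circuit_through:
  assumes nc: "\<And>c. c \<in> V1 \<Longrightarrow> connected_in adj (V1 - {c})"
    and a: "a1 \<in> V1" "a2 \<in> V1" "a3 \<in> V1" "distinct [a1, a2, a3]"
    and b: "b1 \<in> V2" "adj a1 b1"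
  obtains C where "wcircuit adj V1 C" "a1 \<in> set C" "a2 \<in> set C"
proof (cases "adj a1 a2")
  case True
  obtain w where w: "w \<in> V1" "w \<noteq> a1" "w \<noteq> a2" "adj a1 w"
  proof -
    have 1: "{a1} \<subseteq> V1 \<union> V2 - {a2, b1}" using a b disj by auto
    have 2: "a3 \<in> V1 \<union> V2 - {a2, b1} - {a1}" using a b disj by auto
    obtain v where v: "v \<in> V1 \<union> V2 - {a2, b1} - {a1}" "adj a1 v"
      using connected_inD[OF sep 1 _ 2] by (metis singletonD singletonI)
    then have "v \<in> V1" using match1[OF a(1) b(1), of v] b(2) by blast
    then show thesis using v that by blast
  qed
  obtain p where p: "wpath adj (V1 - {a1}) p" "hd p = w" "last p = a2"
    using connected_in_wpath[OF nc[OF a(1)], of w a2] w a by auto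
  then obtain x y q where q: "p = x # y # q"
    using w(3) by (cases p; cases "tl p") (auto simp: wpath_def)
  have "wcircuit adj V1 (a1 # p)"
    using p q w a True sym by (auto simp: wcircuit_def wpath_def)
  moreover have "a2 \<in> set (a1 # p)" using p q last_in_set by fastforce
  ultimately show thesis using that by auto
next
  case False
  define W where "W = V1 - {a1, a2}"
  define S where "S = {x \<in> W. adj a1 x}"
  define T where "T = {x \<in> W. adj a2 x}"
  obtain p q where pq: "wpath adj W p" "wpath adj W q" "set p \<inter> set q = {}"
    "hd p \<in> S" "hd q \<in> S" "last p \<in> T" "last q \<in> T"
  proof (rule two_disjoint_paths)
    show "W \<noteq> {}" using a by (auto simp: W_def)
  next
    fix d X assume d: "d \<in> W" and X: "X \<subseteq> W - {d}" "S \<inter> (W - {d}) \<subseteq> X" "X \<inter> T = {}"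
    have 0: "d \<in> V1" using d by (simp add: W_def)
    \<comment> \<open>The edge leaving \<open>insert a1 X\<close> starts in \<open>X\<close>, since
      every neighbour of \<open>a1\<close> still available belongs to \<open>X\<close>, and misses
      \<open>a2\<close>, since \<open>X\<close> misses \<open>T\<close>.\<close>
    have 1: "insert a1 X \<subseteq> V1 - {d}" using X a d by (auto simp: W_def)
    have 2: "a2 \<in> V1 - {d} - insert a1 X" using X a d by (auto simp: W_def)
    obtain u v where uv: "u \<in> insert a1 X" "v \<in> V1 - {d} - insert a1 X" "adj u v"
      using connected_inD[OF nc[OF 0] 1 insertI1 2] by blast
    have "u \<in> X" using uv X(2) False by (auto simp: S_def W_def)
    moreover have "v \<noteq> a2" using uv \<open>u \<in> X\<close> X(1,3) sym[of u v] by (auto simp: T_def)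
    ultimately show "\<exists>x\<in>X. \<exists>y\<in>W - {d} - X. adj x y" using uv by (auto simp: W_def)
  qed
  have ne: "p \<noteq> []" "q \<noteq> []" and sub: "set p \<subseteq> V1 - {a1, a2}" "set q \<subseteq> V1 - {a1, a2}"
    using pq by (auto simp: wpath_def W_def)
  have adj: "adj a1 (hd p)" "adj (last p) a2" "adj a2 (last q)" "adj (hd q) a1"
    using pq sym by (auto simp: S_def T_def)
  have "wpath adj W (rev q)" using wpath_rev[of adj, OF _ pq(2)] sym by blast
  then have "wcircuit adj V1 (a1 # p @ a2 # rev q)"
    using pq(1,3) ne sub adj a
    by (auto simp: wcircuit_def wpath_def successively_append_iff successively_Cons hd_rev last_rev Suc_le_eq)
  then show thesis using that by auto
qed

text \<open>By \<open>only\<close>, once \<open>a1\<close> and \<open>a2\<close> are deleted,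
  \<open>V1\<close> can be left for \<open>V2\<close> only from \<open>a3\<close>; so
  3-connectedness joins \<open>a3\<close> to the rest of the circuit inside \<open>V1\<close>. If
  \<open>a3\<close> lies on \<open>C\<close>, the tail is a single vertex.\<close>

lemma circuit_with_tail:
  assumes nc: "\<And>c. c \<in> V1 \<Longrightarrow> connected_in adj (V1 - {c})"
    and a: "a1 \<in> V1" "a2 \<in> V1" "a3 \<in> V1" "distinct [a1, a2, a3]"
    and b: "b1 \<in> V2" "adj a1 b1"
    and only: "\<And>a b. a \<in> V1 \<Longrightarrow> b \<in> V2 \<Longrightarrow> adj a b \<Longrightarrow> a \<in> {a1, a2, a3}"
  obtains C r where "wcircuit adj V1 C" "a1 \<in> set C" "a2 \<in> set C"
    "wpath adj V1 r" "hd r = a3" "set r \<inter> set C = {last r}" "last r \<notin> {a1, a2}"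
proof -
  obtain C where C: "wcircuit adj V1 C" "a1 \<in> set C" "a2 \<in> set C"
    using circuit_through[OF nc a b] by blast
  have dC: "distinct C" "length C \<ge> 3" "set C \<subseteq> V1" using C by (auto simp: wcircuit_def wpath_def)
  define T where "T = set C - {a1, a2}"
  have "T \<noteq> {}"
  proof
    assume "T = {}"
    then have "card (set C) \<le> card {a1, a2}" by (intro card_mono) (auto simp: T_def)
    then show False using dC a by (simp add: distinct_card)
  qed
  then obtain t where t: "t \<in> T" by blast
  obtain p where p: "wpath adj (V1 - {a1, a2}) p" "hd p \<in> {a3}" "last p \<in> T"
  proof (rule wpath_between_sets)
    fix X assume X: "X \<subseteq> V1 - {a1, a2}" "{a3} \<inter> (V1 - {a1, a2}) \<subseteq> X" "X \<inter> T = {}"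
    \<comment> \<open>The cut is taken on the complement because \<open>X\<close> contains
      \<open>a3\<close>, from which an edge may lead into \<open>V2\<close>; the edge leaving
      \<open>Z\<close> stays in \<open>V1\<close> and is reversed.\<close>
    define Z where "Z = V1 - {a1, a2} - X"
    have 1: "Z \<subseteq> V1 \<union> V2 - {a1, a2}" by (auto simp: Z_def)
    have 2: "t \<in> Z" using t X dC by (auto simp: Z_def T_def)
    have "a3 \<in> X" using X a by auto
    then have 3: "a3 \<in> V1 \<union> V2 - {a1, a2} - Z" using X a by (auto simp: Z_def)
    obtain u v where uv: "u \<in> Z" "v \<in> V1 \<union> V2 - {a1, a2} - Z" "adj u v"
      using connected_inD[OF sep 1 2 3] by blast
    have "v \<notin> V2" using only[of u v] uv \<open>a3 \<in> X\<close> by (auto simp: Z_def)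
    then have "v \<in> X" "u \<in> V1 - {a1, a2} - X" using uv by (auto simp: Z_def)
    then show "\<exists>x\<in>X. \<exists>y\<in>V1 - {a1, a2} - X. adj x y" using uv(3) sym by blast
  qed
  have "\<exists>x\<in>set p. x \<in> T" using p last_in_set by (auto simp: wpath_def)
  then obtain us z vs where z: "p = us @ z # vs" "z \<in> T" "\<forall>x\<in>set us. x \<notin> T"
    using split_list_first_prop[of p "\<lambda>x. x \<in> T"] by blast
  have w: "wpath adj (V1 - {a1, a2}) (us @ [z])" using p(1) z(1) wpath_prefix by metis
  moreover have "hd (us @ [z]) = a3" using p(2) z(1) by (cases us) auto
  moreover have "set (us @ [z]) \<inter> set C = {z}" using w z by (auto simp: wpath_def T_def)
  moreover have "z \<notin> {a1, a2}" using z by (simp add: T_def)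
  moreover have "wpath adj V1 (us @ [z])" using w by (rule wpath_mono) blast
  ultimately show thesis using that[OF C, of "us @ [z]"] by simp
qed

text \<open>Without a circuit through four cross edges, cut vertices and a fourth cross edge are
  excluded, so each side has a circuit with a tail. The second alternative is a graph of type X in
  terms of lists, with third connector from \<open>hd r\<close> to \<open>hd s\<close>.\<close>

lemma four_cross_or_circuits_with_tails:
  obtains four_cross_circuit
  | C D r s a1 a2 b1 b2 where "wcircuit adj V1 C" "wcircuit adj V2 D"
    "a1 \<in> set C" "a2 \<in> set C" "a1 \<noteq> a2" "b1 \<in> set D" "b2 \<in> set D" "b1 \<noteq> b2"
    "adj a1 b1" "adj a2 b2" "wpath adj V1 r" "wpath adj V2 s" "adj (hd r) (hd s)"
    "set r \<inter> set C = {last r}" "last r \<notin> {a1, a2}"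
    "set s \<inter> set D = {last s}" "last s \<notin> {b1, b2}"
proof -
  interpret sw: two_sided_cut adj V2 V1 by (rule swapped)
  have sw4: four_cross_circuit if sw4: "sw.four_cross_circuit"
  proof -
    obtain C b1 b2 b3 b4 a1 a2 a3 a4 where C: "wcircuit adj (V2 \<union> V1) C"
      "{b1, b2, b3, b4} \<subseteq> V2" "{a1, a2, a3, a4} \<subseteq> V1" "distinct [b1, b2, b3, b4]"
      "distinct [a1, a2, a3, a4]" "{{b1, a1}, {b2, a2}, {b3, a3}, {b4, a4}} \<subseteq> circuit_edges C"
      using sw4 unfolding sw.four_cross_circuit_def by (elim exE conjE) (rule that)
    have "wcircuit adj (V1 \<union> V2) C" using C(1) by (simp only: Un_commute)
    moreover have "{{a1, b1}, {a2, b2}, {a3, b3}, {a4, b4}} \<subseteq> circuit_edges C"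
      using C(6) by (simp only: insert_commute[of _ _ "{}"])
    ultimately show ?thesis using C(2-5) unfolding four_cross_circuit_def by (intro exI conjI)
  qed
  show thesis
  proof (cases four_cross_circuit)
    case False
    have nc1: "connected_in adj (V1 - {c})" if "c \<in> V1" for c
      using cutvertex_four_cross_circuit that False by blast
    have nc2: "connected_in adj (V2 - {c})" if "c \<in> V2" for c
      using sw.cutvertex_four_cross_circuit that False sw4 by blast
    obtain a where "a \<in> V1" using nonempty1 by blast
    then obtain a1 b1 where 1: "a1 \<in> V1" "b1 \<in> V2" "adj a1 b1"
      using cross_edge_avoiding[of a a] by blast
    obtain a2 b2 where 2: "a2 \<in> V1 - {a1}" "b2 \<in> V2" "adj a2 b2"
      using cross_edge_avoiding[of a1 a1] 1 by blast
    then obtain a3 b3 where 3: "a3 \<in> V1 - {a1, a2}" "b3 \<in> V2" "adj a3 b3"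
      using cross_edge_avoiding[of a1 a2] 1 by blast
    have only1: "x \<in> {a1, a2, a3}" if "x \<in> V1" "y \<in> V2" "adj x y" for x y
      using four_cross_of_four_edges[OF nc1 nc2, of a1 a2 a3 x b1 b2 b3 y] 1 2 3 that False by auto
    have only2: "y \<in> {b1, b2, b3}" if "y \<in> V2" "x \<in> V1" "adj y x" for x y
      using only1[of x y] that 1 2 3 match1[of x y] sym by blast
    have db: "distinct [b1, b2, b3]" using 1 2 3 match2 by auto
    obtain C r where C: "wcircuit adj V1 C" "a1 \<in> set C" "a2 \<in> set C"
      "wpath adj V1 r" "hd r = a3" "set r \<inter> set C = {last r}" "last r \<notin> {a1, a2}"
      by (rule circuit_with_tail[of a1 a2 a3 b1]) (use nc1 1 2 3 only1 in auto)
    obtain D s where D: "wcircuit adj V2 D" "b1 \<in> set D" "b2 \<in> set D"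
      "wpath adj V2 s" "hd s = b3" "set s \<inter> set D = {last s}" "last s \<notin> {b1, b2}"
      by (rule sw.circuit_with_tail[of b1 b2 b3 a1]) (use nc2 1 2 3 only2 db sym in auto)
    have "a1 \<noteq> a2" "b1 \<noteq> b2" "adj (hd r) (hd s)" using 2 3 db C D by auto
    then show thesis using that(2)[of C D a1 a2 b1 b2 r s] 1 2 C D by blast
  qed (rule that(1))
qed

end

subsection \<open>Components and circuits of graphs\<close>

abbreviation nbr :: "'a ugraph \<Rightarrow> 'a \<Rightarrow> 'a \<Rightarrow> bool" where
  "nbr G x y \<equiv> {x, y} \<in> edges G"

lemma simple_graph_subgraphI:
  assumes "simple_graph G" "verts H \<subseteq> verts G" "edges H \<subseteq> edges G"
    "\<And>e. e \<in> edges H \<Longrightarrow> e \<subseteq> verts H"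
  shows "subgraph H G"
  using assms by (auto simp: subgraph_def simple_graph_def)

text \<open>List paths inside \<open>verts H\<close> correspond to path subgraphs; this carries the
  hypotheses on graphs over to the cut form of connectedness.\<close>

lemma connected_graph_iff:
  assumes "simple_graph H"
  shows "connected_graph H \<longleftrightarrow> verts H \<noteq> {} \<and> connected_in (nbr H) (verts H)"
proof
  assume *: "connected_graph H"
  have "\<exists>p. wpath (nbr H) (verts H) p \<and> hd p = x \<and> last p = y"
    if xy: "x \<in> verts H" "y \<in> verts H" for x y
  proof -
    obtain P where P: "subgraph P H" "is_path P x y"
      using * xy unfolding connected_graph_def by blast
    then obtain p where "p \<noteq> []" "distinct p" "hd p = x" "last p = y"
      "verts P = set p" "edges P = consecutive_edges p" unfolding is_path_def by blast
    then have "wpath (nbr H) (verts H) p"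
      using P(1) consecutive_edges_subset_iff[of p "edges H"] by (auto simp: wpath_def subgraph_def)
    then show ?thesis using \<open>hd p = x\<close> \<open>last p = y\<close> by blast
  qed
  then have "connected_in (nbr H) (verts H)" by (rule wpath_connected_in)
  then show "verts H \<noteq> {} \<and> connected_in (nbr H) (verts H)"
    using * by (simp add: connected_graph_def)
next
  assume *: "verts H \<noteq> {} \<and> connected_in (nbr H) (verts H)"
  have "\<exists>P. subgraph P H \<and> is_path P x y" if xy: "x \<in> verts H" "y \<in> verts H" for x y
  proof -
    obtain p where p: "wpath (nbr H) (verts H) p" "hd p = x" "last p = y"
      using * xy connected_in_wpath by metis
    define P where "P = \<lparr>verts = set p, edges = consecutive_edges p\<rparr>"
    have "subgraph P H" using assms
      by (rule simple_graph_subgraphI)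
        (use p consecutive_edges_subset_iff[of p "edges H"] in
          \<open>auto simp: P_def wpath_def dest: consecutive_edges_verts\<close>)
    moreover have "is_path P x y" using p unfolding is_path_def P_def wpath_def by auto
    ultimately show ?thesis by blast
  qed
  then show "connected_graph H" using * by (simp add: connected_graph_def)
qed

text \<open>Adding the edge to \<open>H\<close> keeps it connected, so by maximality the edge and
  its end \<open>y\<close> belonged to \<open>H\<close> already.\<close>

lemma components_closed:
  assumes "simple_graph D" "H \<in> components D" "x \<in> verts H" "nbr D x y"
  shows "y \<in> verts H"
proof -
  have H: "subgraph H D" "connected_graph H"
    "\<And>K. subgraph K D \<Longrightarrow> connected_graph K \<Longrightarrow> subgraph H K \<Longrightarrow> K = H"
    using assms(2) unfolding components_def by blast+
  define K where "K = \<lparr>verts = verts H \<union> {x, y}, edges = insert {x, y} (edges H)\<rparr>"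
  have sub: "{x, y} \<subseteq> verts D" "card {x, y} = 2" "verts H \<subseteq> verts D" "edges H \<subseteq> edges D" "simple_graph H"
    using assms(1,4) H(1) unfolding simple_graph_def subgraph_def by blast+
  have K: "simple_graph K" using sub by (auto simp: K_def simple_graph_def)
  have "connected_in (nbr H) (verts H)" using H(2) sub by (simp add: connected_graph_iff)
  then have "connected_in (nbr K) (verts H)" by (rule connected_in_mono) (simp add: K_def)
  moreover have "connected_in (nbr K) {x, y}"
  proof (rule connected_in_pointed[where c = x])
    fix X assume "X \<subseteq> {x, y} - {x}" "X \<noteq> {}"
    then have "y \<in> X" "x \<in> {x, y} - X" by auto
    moreover have "nbr K y x" by (simp add: K_def insert_commute)
    ultimately show "\<exists>u\<in>X. \<exists>v\<in>{x, y} - X. nbr K u v" by blast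
  qed (simp add: insert_commute)
  ultimately have "connected_in (nbr K) (verts H \<union> {x, y})"
    by (rule connected_in_Un) (use assms(3) in auto)
  then have "connected_graph K" using K by (simp add: connected_graph_iff) (simp add: K_def)
  moreover have "subgraph K D" using K sub assms(4) by (auto simp: K_def subgraph_def)
  moreover have "subgraph H K" using sub by (auto simp: K_def subgraph_def)
  ultimately have "K = H" using H(3) by blast
  then have "verts K = verts H" by simp
  then show ?thesis by (auto simp: K_def)
qed

text \<open>If they met, their union would be connected, and maximality would make both equal to
  it.\<close>

lemma components_disjoint:
  assumes "H \<in> components D" "H' \<in> components D" "H \<noteq> H'"
  shows "verts H \<inter> verts H' = {}"
proof (rule ccontr)
  assume "verts H \<inter> verts H' \<noteq> {}"
  then obtain x where x: "x \<in> verts H" "x \<in> verts H'" by blast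
  have H: "subgraph H D" "connected_graph H"
    "\<And>K. subgraph K D \<Longrightarrow> connected_graph K \<Longrightarrow> subgraph H K \<Longrightarrow> K = H"
    using assms(1) unfolding components_def by blast+
  have H': "subgraph H' D" "connected_graph H'"
    "\<And>K. subgraph K D \<Longrightarrow> connected_graph K \<Longrightarrow> subgraph H' K \<Longrightarrow> K = H'"
    using assms(2) unfolding components_def by blast+
  define K where "K = \<lparr>verts = verts H \<union> verts H', edges = edges H \<union> edges H'\<rparr>"
  have s: "simple_graph H" "simple_graph H'" using H H' by (simp_all add: subgraph_def)
  then have K: "simple_graph K" by (auto simp: K_def simple_graph_def)
  have "connected_in (nbr H) (verts H)" "connected_in (nbr H') (verts H')"
    using H(2) H'(2) s by (simp_all add: connected_graph_iff)
  then have "connected_in (nbr K) (verts H)" "connected_in (nbr K) (verts H')"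
    by (auto elim!: connected_in_mono simp: K_def)
  then have "connected_in (nbr K) (verts H \<union> verts H')"
    by (rule connected_in_Un) (use x in auto)
  then have "connected_graph K" using K x by (simp add: connected_graph_iff) (auto simp: K_def)
  moreover have "subgraph K D" "subgraph H K" "subgraph H' K"
    using K s H(1) H'(1) by (auto simp: K_def subgraph_def)
  ultimately have "K = H" "K = H'" using H(3) H'(3) by blast+
  then show False using assms(3) by simp
qed

lemma is_circuit_wcircuit:
  assumes "simple_graph G" "wcircuit (nbr G) W p" "W \<subseteq> verts G"
  defines "C \<equiv> \<lparr>verts = set p, edges = circuit_edges p\<rparr>"
  shows "is_circuit C" "subgraph C G"
proof -
  have p: "length p \<ge> 3" "p \<noteq> []" "distinct p" "set p \<subseteq> W" "consecutive_edges p \<subseteq> edges G"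
    "{last p, hd p} \<in> edges G"
    using assms(2) by (auto simp: wcircuit_def wpath_def consecutive_edges_subset_iff)
  then show "is_circuit C" unfolding is_circuit_def C_def circuit_edges_def by auto
  show "subgraph C G" using assms(1)
    by (rule simple_graph_subgraphI)
      (use p assms(3) in \<open>auto simp: C_def circuit_edges_def dest: consecutive_edges_verts\<close>)
qed

section \<open>Translation to graphs and the two outcomes\<close>

theorem theorem4:
  fixes G G1 G2 :: "'a ugraph" and A :: "'a set set"
  assumes "simple_graph G"
    and "k_connected 3 G"
    and "A \<subseteq> edges G" and "finite A"
    and "\<forall>e\<in>A. \<forall>f\<in>A. e \<noteq> f \<longrightarrow> e \<inter> f = {}"
    and "components (delete_edges G A) = {G1, G2}" and "G1 \<noteq> G2"
    and "\<forall>e\<in>A. \<exists>u\<in>verts G1. \<exists>v\<in>verts G2. e = {u, v}"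
  shows "(\<exists>H e1 e2 e3. subgraph H G \<and> type_X H e1 e2 e3 \<and> {e1, e2, e3} \<subseteq> A)
       \<or> (\<exists>C. is_circuit C \<and> subgraph C G \<and> card (edges C \<inter> A) \<ge> 4)"
proof -
  define D where "D = delete_edges G A"
  define V1 where "V1 = verts G1"
  define V2 where "V2 = verts G2"
  have D: "simple_graph D" "verts D = verts G" "edges D = edges G - A"
    using assms(1) by (auto simp: D_def delete_edges_def simple_graph_def)
  have comp: "G1 \<in> components D" "G2 \<in> components D" using assms(6) by (auto simp: D_def)
  then have sub: "subgraph G1 D" "subgraph G2 D" and con: "connected_graph G1" "connected_graph G2"
    unfolding components_def by auto
  have closed1: "y \<in> V1" if "x \<in> V1" "{x, y} \<in> edges G - A" for x y
    using components_closed[OF D(1) comp(1)] that D unfolding V1_def by simp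
  have closed2: "y \<in> V2" if "x \<in> V2" "{x, y} \<in> edges G - A" for x y
    using components_closed[OF D(1) comp(2)] that D unfolding V2_def by simp
  have disj: "V1 \<inter> V2 = {}" using components_disjoint[OF comp assms(7)] by (simp add: V1_def V2_def)
  have V: "V1 \<subseteq> verts G" "V2 \<subseteq> verts G" "V1 \<noteq> {}" "V2 \<noteq> {}"
    using sub con D by (auto simp: V1_def V2_def subgraph_def connected_graph_def)
  have conn: "connected_in (nbr G) V1" "connected_in (nbr G) V2"
    unfolding V1_def V2_def using con sub D
    by (auto simp: connected_graph_iff subgraph_def elim!: connected_in_mono)
  \<comment> \<open>\<open>V1\<close> is closed under edges outside \<open>A\<close>, so an edge
    that leaves it for \<open>V2\<close> belongs to \<open>A\<close>.\<close>
  have inA: "{a, b} \<in> A" if "a \<in> V1" "b \<in> V2" "nbr G a b" for a b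
    using closed1[of a b] that disj by blast
  have sep0: "connected_in (nbr G) (verts G - T)" if T: "T \<subseteq> verts G" "finite T" "card T < 3" for T
  proof -
    have "simple_graph (delete_verts G T)"
      using assms(1) by (auto simp: delete_verts_def simple_graph_def)
    moreover have "connected_graph (delete_verts G T)"
      using assms(2) T unfolding k_connected_def by blast
    ultimately have "connected_in (nbr (delete_verts G T)) (verts (delete_verts G T))"
      by (simp add: connected_graph_iff)
    then show ?thesis
      by (auto simp: delete_verts_def elim!: connected_in_mono)
  qed
  have cover: "V1 \<union> V2 = verts G"
  proof (rule ccontr)
    assume n: "V1 \<union> V2 \<noteq> verts G"
    obtain x where "x \<in> V1 \<union> V2" using V by blast
    moreover obtain y where "y \<in> verts G - (V1 \<union> V2)" using n V by blast
    moreover have "connected_in (nbr G) (verts G)" using sep0[of "{}"] by simp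
    moreover have "V1 \<union> V2 \<subseteq> verts G" using V by blast
    \<comment> \<open>This edge would have to lie in \<open>A\<close>, as both parts are closed
      under other edges, yet all edges of \<open>A\<close> stay inside
      \<open>V1 \<union> V2\<close>.\<close>
    ultimately obtain u v where uv: "u \<in> V1 \<union> V2" "v \<in> verts G - (V1 \<union> V2)" "{u, v} \<in> edges G"
      using connected_inD[of "nbr G" "verts G"] by metis
    then have "{u, v} \<in> A" using closed1[of u v] closed2[of u v] by blast
    then obtain a b where "a \<in> V1" "b \<in> V2" "{u, v} = {a, b}"
      using assms(8) unfolding V1_def V2_def by blast
    then have "v \<in> V1 \<union> V2" by (metis UnCI insertCI insertE singletonD)
    then show False using uv by blast
  qed
  have A_eq: "e = f" if "e \<in> A" "f \<in> A" "e \<inter> f \<noteq> {}" for e f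
    using assms(5) that by metis
  interpret two_sided_cut "nbr G" V1 V2
  proof
    show "nbr G x y \<Longrightarrow> nbr G y x" for x y by (simp add: insert_commute)
    show "b = b'" if "a \<in> V1" "b \<in> V2" "b' \<in> V2" "nbr G a b" "nbr G a b'" for a b b'
    proof -
      have "{a, b} \<in> A" "{a, b'} \<in> A" using inA that by blast+
      then have "{a, b} = {a, b'}" by (rule A_eq) simp
      then show ?thesis by (auto simp: doubleton_eq_iff)
    qed
    show "a = a'" if "a \<in> V1" "a' \<in> V1" "b \<in> V2" "nbr G a b" "nbr G a' b" for a a' b
    proof -
      have "{a, b} \<in> A" "{a', b} \<in> A" using inA that by blast+
      then have "{a, b} = {a', b}" by (rule A_eq) simp
      then show ?thesis by (auto simp: doubleton_eq_iff)
    qed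
    show "connected_in (nbr G) (V1 \<union> V2 - {c, d})" for c d
    proof -
      \<comment> \<open>\<open>c\<close> and \<open>d\<close> may lie outside
        \<open>verts G\<close>, hence the intersection.\<close>
      have "card (verts G \<inter> {c, d}) \<le> card {c, d}" by (intro card_mono) auto
      also have "\<dots> < 3" by (cases "c = d") auto
      finally have "connected_in (nbr G) (verts G - verts G \<inter> {c, d})" by (intro sep0) auto
      then show ?thesis using cover by (simp add: Diff_Int_distrib Diff_Int)
    qed
    show "\<not> V1 \<union> V2 \<subseteq> {x, y, z}" for x y z
    proof
      assume "V1 \<union> V2 \<subseteq> {x, y, z}"
      then have "finite (verts G)" "card (verts G) \<le> card {x, y, z}"
        using cover by (auto intro: finite_subset card_mono)
      moreover have "card {x, y, z} \<le> 3" by (simp add: card_insert_if)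
      ultimately show False using assms(2) unfolding k_connected_def by linarith
    qed
  qed (use disj V conn in auto)
  show ?thesis
  proof (rule four_cross_or_circuits_with_tails)
    assume four_cross_circuit
    then obtain C a1 a2 a3 a4 b1 b2 b3 b4 where C: "wcircuit (nbr G) (V1 \<union> V2) C"
      "{a1, a2, a3, a4} \<subseteq> V1" "{b1, b2, b3, b4} \<subseteq> V2" "distinct [a1, a2, a3, a4]"
      "distinct [b1, b2, b3, b4]" "{{a1, b1}, {a2, b2}, {a3, b3}, {a4, b4}} \<subseteq> circuit_edges C"
      unfolding four_cross_circuit_def by (elim exE conjE) (rule that)
    define K where "K = \<lparr>verts = set C, edges = circuit_edges C\<rparr>"
    have K: "is_circuit K" "subgraph K G"
      unfolding K_def using is_circuit_wcircuit[OF assms(1) C(1)] cover by auto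
    let ?F = "{{a1, b1}, {a2, b2}, {a3, b3}, {a4, b4}}"
    have "circuit_edges C \<subseteq> edges G" using K(2) by (simp add: K_def subgraph_def)
    with C(6) have "?F \<subseteq> edges G" by (rule order_trans)
    then have "?F \<subseteq> A" using C(2,3) inA by simp
    then have "?F \<subseteq> edges K \<inter> A" using C(6) by (simp add: K_def)
    then have "card ?F \<le> card (edges K \<inter> A)" using assms(4) by (intro card_mono) auto
    moreover have "card ?F = 4"
      using C(2-5) disj by (auto simp: card_insert_if doubleton_eq_iff)
    ultimately show ?thesis using K by auto
  next
    fix C D r s a1 a2 b1 b2
    assume C: "wcircuit (nbr G) V1 C" "wcircuit (nbr G) V2 D"
      and a: "a1 \<in> set C" "a2 \<in> set C" "a1 \<noteq> a2" and b: "b1 \<in> set D" "b2 \<in> set D" "b1 \<noteq> b2"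
      and e: "nbr G a1 b1" "nbr G a2 b2"
      and r: "wpath (nbr G) V1 r" "wpath (nbr G) V2 s" "nbr G (hd r) (hd s)"
      and ra: "set r \<inter> set C = {last r}" "last r \<notin> {a1, a2}"
      and sb: "set s \<inter> set D = {last s}" "last s \<notin> {b1, b2}"
    define A0 where "A0 = \<lparr>verts = set C, edges = circuit_edges C\<rparr>"
    define B0 where "B0 = \<lparr>verts = set D, edges = circuit_edges D\<rparr>"
    \<comment> \<open>\<open>r\<close> runs from the third cross edge to \<open>C\<close>, so it is
      reversed; that edge joins the two halves of \<open>P\<close>.\<close>
    define p where "p = rev r @ s"
    define P where "P = \<lparr>verts = set p, edges = consecutive_edges p\<rparr>"
    define H where "H = \<lparr>verts = set C \<union> set D \<union> set p,
      edges = circuit_edges C \<union> circuit_edges D \<union> consecutive_edges p \<union> {{a1, b1}, {a2, b2}}\<rparr>"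
    have A0: "is_circuit A0" "subgraph A0 G"
      unfolding A0_def using is_circuit_wcircuit[OF assms(1) C(1)] V by auto
    have B0: "is_circuit B0" "subgraph B0 G"
      unfolding B0_def using is_circuit_wcircuit[OF assms(1) C(2)] V by auto
    have ne: "r \<noteq> []" "s \<noteq> []" and ss: "set r \<subseteq> V1" "set s \<subseteq> V2" "set C \<subseteq> V1" "set D \<subseteq> V2"
      using r C by (auto simp: wpath_def wcircuit_def)
    have "wpath (nbr G) V1 (rev r)" using wpath_rev[of "nbr G", OF _ r(1)] sym by blast
    then have "wpath (nbr G) (V1 \<union> V2) (rev r)" "wpath (nbr G) (V1 \<union> V2) s"
      using r(2) by (auto elim: wpath_mono)
    then have p: "wpath (nbr G) (V1 \<union> V2) p" unfolding p_def
      by (rule wpath_append) (use ss disj r(3) ne in \<open>auto simp: last_rev\<close>)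
    then have "is_path P (last r) (last s)"
      unfolding is_path_def P_def wpath_def
      by (intro exI[of _ p]) (use ne in \<open>auto simp: p_def hd_rev\<close>)
    moreover have "{hd r, hd s} \<in> edges P"
      using ne by (simp add: P_def p_def consecutive_edges_append last_rev)
    moreover have "verts P \<inter> (verts A0 \<union> verts B0) = {last r, last s}"
      using ra(1) sb(1) ss disj by (auto simp: P_def A0_def B0_def p_def)
    moreover have "verts A0 \<inter> verts B0 = {}" using ss disj by (auto simp: A0_def B0_def)
    moreover have "{a1, a2, last r} \<subseteq> verts A0" "distinct [a1, a2, last r]"
      "{b1, b2, last s} \<subseteq> verts B0" "distinct [b1, b2, last s]"
      using a b ra sb by (auto simp: A0_def B0_def)
    moreover have "verts H = verts A0 \<union> verts B0 \<union> verts P"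
      "edges H = edges A0 \<union> edges B0 \<union> edges P \<union> {{a1, b1}, {a2, b2}}"
      by (simp_all add: H_def A0_def B0_def P_def)
    ultimately have X: "type_X H {a1, b1} {a2, b2} {hd r, hd s}"
      unfolding type_X_def using A0(1) B0(1) by blast
    have "subgraph H G" using assms(1)
    proof (rule simple_graph_subgraphI)
      show "verts H \<subseteq> verts G" using ss cover by (auto simp: H_def p_def)
      have "consecutive_edges p \<subseteq> edges G"
        using p consecutive_edges_subset_iff[of p "edges G"] by (simp add: wpath_def)
      then show "edges H \<subseteq> edges G"
        using A0(2) B0(2) e by (auto simp: H_def A0_def B0_def subgraph_def)
      show "f \<subseteq> verts H" if "f \<in> edges H" for f
      proof -
        have "f \<subseteq> set C" if "f \<in> circuit_edges C"
          using A0(2) that by (auto simp: A0_def subgraph_def simple_graph_def)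
        moreover have "f \<subseteq> set D" if "f \<in> circuit_edges D"
          using B0(2) that by (auto simp: B0_def subgraph_def simple_graph_def)
        ultimately show ?thesis
          using that a b consecutive_edges_verts[of f p] by (auto simp: H_def)
      qed
    qed
    moreover have "{{a1, b1}, {a2, b2}, {hd r, hd s}} \<subseteq> A"
      using inA a b ss e r(3) ne hd_in_set by (simp add: subset_iff)
    ultimately show ?thesis using X by blast
  qed
qed

end
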